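(* Let $C\subset\mathbb{R}^n$ be a centrally symmetric bounded convex body centered at the origin, and consider the Minkowski space $(\mathbb{R}^n,C)$. Suppose $\mathbb{R}^n$ admits a subregular proper $k$-coloring with color classes $C_1,\dots,C_k$, defined by the set $C_1$ (which contains no two points at unit $C$-distance) and vectors $v_1,\dots,v_k$, i.e. $C_i\subseteq C_1+v_i$ for each $i$. Then there exist a red-blue coloring of $\mathbb{R}^n$ and the $k$-point configuration $K=\{-v_1,-v_2,\dots,-v_k\}$ such that the red color class contains no two points at unit $C$-distance and the blue color class contains no translate $K+m$, $m\in\mathbb{R}^n$.
   Context: The $C$-norm of $x\in\mathbb{R}^n$ is $\|x\|_C=\min\{\lambda>0: x\in\lambda C\}$ and the $C$-distance of $x,y$ is $\|x-y\|_C$. A proper $k$-coloring of $(\mathbb{R}^n,C)$ is a partition of $\mathbb{R}^n$ into $k$ color classes $C_1,\dots,C_k$ none of which contains two points at unit $C$-distance. Such a coloring is called subregular if there exist vectors $v_1,\dots,v_k$ such that $C_i\subseteq C_1+v_i$ for $i=1,\dots,k$.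
   Formalization: That K has exactly k points is asserted only when v_1,…,v_k are distinct; the hypotheses do not force this, and if some v_i coincide the set K has fewer than k points. All other conclusions are stated without that restriction. *)

theory Defs
  imports "HOL-Analysis.Analysis"
begin

definition symmetric_convex_body :: "(real ^ 'n) set \<Rightarrow> bool" where
  "symmetric_convex_body C \<longleftrightarrow>
     compact C \<and> convex C \<and> interior C \<noteq> {} \<and> uminus ` C = C"

(* For a symmetric convex body and x \<noteq> 0 the infimum is attained, so it is a minimum.
   For x = 0 the set is {0<..}, which has no minimum; the infimum gives the value 0. *)
definition C_norm :: "(real ^ 'n) set \<Rightarrow> real ^ 'n \<Rightarrow> real" where
  "C_norm C x = Inf {l. l > 0 \<and> x \<in> (\<lambda>y. l *\<^sub>R y) ` C}"

definition C_dist :: "(real ^ 'n) set \<Rightarrow> real ^ 'n \<Rightarrow> real ^ 'n \<Rightarrow> real" where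
  "C_dist C x y = C_norm C (x - y)"

definition avoids_unit_distance :: "(real ^ 'n) set \<Rightarrow> (real ^ 'n) set \<Rightarrow> bool" where
  "avoids_unit_distance C S \<longleftrightarrow> \<not> (\<exists>x\<in>S. \<exists>y\<in>S. C_dist C x y = 1)"

(* The classes are A 1, ..., A k; values of A outside {1..k} are irrelevant.
   As usual for k-colorings, some colors may be unused. *)
definition proper_coloring :: "(real ^ 'n) set \<Rightarrow> nat \<Rightarrow> (nat \<Rightarrow> (real ^ 'n) set) \<Rightarrow> bool" where
  "proper_coloring C k A \<longleftrightarrow>
     (\<Union>i\<in>{1..k}. A i) = UNIV \<and> disjoint_family_on A {1..k} \<and>
     (\<forall>i\<in>{1..k}. avoids_unit_distance C (A i))"

definition subregular_with :: "nat \<Rightarrow> (nat \<Rightarrow> (real ^ 'n) set) \<Rightarrow> (nat \<Rightarrow> real ^ 'n) \<Rightarrow> bool" where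
  "subregular_with k A v \<longleftrightarrow> (\<forall>i\<in>{1..k}. A i \<subseteq> (\<lambda>x. x + v i) ` A 1)"

end

theory Submission
  imports Defs
begin

text \<open>Take \<open>A 1\<close> as red and its complement as blue. Red avoids unit distance
  because it is a class of a proper coloring. A translate of \<open>K\<close> by \<open>m\<close>
  cannot be entirely blue: the classes cover the space, so \<open>m\<close> lies in some
  \<open>A i\<close>, hence in \<open>A 1 + v i\<close>, and then the point \<open>m - v i\<close>
  of the translate is red.\<close>

theorem theorem2:
  fixes C :: "(real ^ 'n) set" and k :: nat
    and A :: "nat \<Rightarrow> (real ^ 'n) set" and v :: "nat \<Rightarrow> real ^ 'n"
  assumes "symmetric_convex_body C"
    and "proper_coloring C k A"
    and "subregular_with k A v"
  shows "\<exists>Red Blue K :: (real ^ 'n) set.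
           Red \<union> Blue = UNIV \<and> Red \<inter> Blue = {} \<and>
           K = (\<lambda>i. - v i) ` {1..k} \<and> (inj_on v {1..k} \<longrightarrow> card K = k) \<and>
           avoids_unit_distance C Red \<and>
           \<not> (\<exists>m. (\<lambda>x. x + m) ` K \<subseteq> Blue)"
proof -
  let ?K = "(\<lambda>i. - v i) ` {1..k}"
  have cover: "(\<Union>i\<in>{1..k}. A i) = UNIV"
    and avoids: "\<forall>i\<in>{1..k}. avoids_unit_distance C (A i)"
    using assms(2) unfolding proper_coloring_def by blast+
  \<comment> \<open>With \<open>k = 0\<close> the union of the classes would be empty, yet it is the
    whole space. So \<open>A 1\<close> really is one of the color classes.\<close>
  have "1 \<in> {1..k}"
    using cover by (cases "k = 0") auto
  then have red: "avoids_unit_distance C (A 1)"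
    using avoids by blast
  \<comment> \<open>Repeated vectors collapse in the image \<open>?K\<close>, so the count
    \<open>k\<close> is claimed for distinct \<open>v i\<close> only.\<close>
  have card: "card ?K = k" if "inj_on v {1..k}"
  proof -
    have "inj_on (\<lambda>i. - v i) {1..k}"
      using that unfolding inj_on_def neg_equal_iff_equal .
    then show ?thesis by (simp add: card_image)
  qed
  have blue: "\<not> (\<lambda>x. x + m) ` ?K \<subseteq> - A 1" for m
  proof -
    \<comment> \<open>The translation vector is itself read as a point of the colored space; its
      color \<open>i\<close> selects the red point \<open>- v i + m\<close>.\<close>
    obtain i where i: "i \<in> {1..k}" "m \<in> A i"
      using cover by blast
    then obtain x where x: "x \<in> A 1" "m = x + v i"
      using assms(3) unfolding subregular_with_def by blast
    then have "x = - v i + m" by simp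
    then have "x \<in> (\<lambda>x. x + m) ` ?K"
      using i(1) by blast
    with x(1) show ?thesis by blast
  qed
  show ?thesis
  proof (rule exI[of _ "A 1"], rule exI[of _ "- A 1"], rule exI[of _ ?K], intro conjI impI)
    show "card ?K = k" if "inj_on v {1..k}"
      using that by (rule card)
    show "avoids_unit_distance C (A 1)"
      by (rule red)
    show "\<not> (\<exists>m. (\<lambda>x. x + m) ` ?K \<subseteq> - A 1)"
      using blue by blast
  qed simp_all
qed

end
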